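(* Let $y\in Y^D$ be exact data such that $\mathcal A(x)=y$ has at least one solution $x\in X^B$, let $x_0\in X^B$, and let $(x_k)_{k\in\mathbb N}$ be defined by the BCD iteration with exact data $$x_{k+1}=x_k-s_k\,\mathcal P_{b(k)}\mathcal A^*(\mathcal A(x_k)-y),\qquad k\in\mathbb N .$$ Assume there are constants $0<s_{\min}\le s_{\max}$ and $\theta_{\max}<2$ such that for all $k\in\mathbb N$: $s_{\min}\le s_k\le s_{\max}$, $s_k\in(0,2A_k)$, and $s_k/A_k\le\theta_{\max}$, where $$A_k:=\frac{\|v_{b(k)}\|^2\,\|\mathcal Q^Y_{b(k)}(y-\mathcal A(x_k))\|^2}{\|\mathcal V_X\mathcal P_{b(k)}\mathcal A^*(y-\mathcal A(x_k))\|^2}.$$ Then $x_k\to x^+$ in norm as $k\to\infty$, where $x^+$ is the solution of $\mathcal A(x)=y$ with minimal distance to $x_0$.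
   Context: $\mathbb N=\{0,1,2,\dots\}$. $X,Y$ are real Hilbert spaces, $B,D\ge 1$ integers, and $X^B$, $X^D$, $Y^D$ carry the product Hilbert space structure. $K\colon X\to Y$ is bounded linear, and $V=(V_{d,b})\in\mathbb R^{D\times B}$ is a matrix of rank $B$ with (nonzero) columns $v_1,\dots,v_B\in\mathbb R^D$. The forward operator is $\mathcal A=V\otimes K\colon X^B\to Y^D$, i.e. $(\mathcal A x)[d]=\sum_{b=1}^B V_{d,b}K(x[b])$; $\mathcal A^*$ is its adjoint. $\mathcal V_X=V\otimes \mathrm{Id}_X\colon X^B\to X^D$, $(\mathcal V_X x)[d]=\sum_{b}V_{d,b}\,x[b]$. For $b\in\{1,\dots,B\}$, $\mathcal P_b\colon X^B\to X^B$ keeps the $b$-th block and sets all other blocks to $0$. $\mathcal Q^Y_b=\|v_b\|^{-2}(v_bv_b^{\mathsf T})\otimes \mathrm{Id}_Y\colon Y^D\to Y^D$, which is an orthogonal projection. The control $b\colon\mathbb N\to\{1,\dots,B\}$ satisfies: there is an integer $p\ge1$ such that for all $k\in\mathbb N$, $\{b(k),\dots,b(k+p-1)\}=\{1,\dots,B\}$. Convention: $A_k=+\infty$ (and $s_k/A_k=0$) if its denominator is $0$. *)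

theory Defs
  imports "HOL-Analysis.Analysis"
begin

text \<open>
  The Hilbert space powers \<open>X\<^sup>B\<close> and \<open>X\<^sup>D\<close> are the types
  \<^typ>\<open>'x ^ 'b\<close> and \<^typ>\<open>'x ^ 'd\<close>, whose library inner product is the sum of the
  blockwise inner products; \<open>B\<close> and \<open>D\<close> are the cardinalities of the finite index types.
\<close>

definition mat_tensor ::
  "real ^ 'b ^ 'd \<Rightarrow> ('x::real_vector \<Rightarrow> 'y::real_vector) \<Rightarrow> 'x ^ 'b \<Rightarrow> 'y ^ 'd"  (infixr "\<otimes>\<^sub>M" 75)
  where "V \<otimes>\<^sub>M T = (\<lambda>x. \<chi> d. \<Sum>b\<in>UNIV. (V $ d $ b) *\<^sub>R T (x $ b))"

definition block_proj :: "'b \<Rightarrow> 'x::real_vector ^ 'b \<Rightarrow> 'x ^ 'b"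
  where "block_proj b x = (\<chi> i. if i = b then x $ i else 0)"

definition outer_prod :: "real ^ 'd \<Rightarrow> real ^ 'd \<Rightarrow> real ^ 'd ^ 'd"
  where "outer_prod u v = (\<chi> i j. u $ i * v $ j)"

definition col_proj :: "real ^ 'b ^ 'd \<Rightarrow> 'b \<Rightarrow> 'y::real_vector ^ 'd \<Rightarrow> 'y ^ 'd"
  where "col_proj V b =
    (inverse ((norm (column b V))\<^sup>2) *\<^sub>R outer_prod (column b V) (column b V)) \<otimes>\<^sub>M id"

text \<open>
  The upper bound \<open>A\<^sub>k\<close> for the residual \<open>r = y - \<A>(x\<^sub>k)\<close> and the block \<open>b = b(k)\<close>.
  It is extended-real valued since its denominator may vanish; division by
  \<open>\<infinity>\<close> in \<^typ>\<open>ereal\<close> gives \<open>0\<close>.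
\<close>

definition step_bound ::
  "real ^ 'b ^ 'd \<Rightarrow> ('x::real_inner \<Rightarrow> 'y::real_inner) \<Rightarrow> 'b \<Rightarrow> 'y ^ 'd \<Rightarrow> ereal"
  where "step_bound V K b r =
    (let num = (norm (column b V))\<^sup>2 * (norm (col_proj V b r))\<^sup>2;
         den = (norm ((V \<otimes>\<^sub>M id) (block_proj b (adjoint (V \<otimes>\<^sub>M K) r))))\<^sup>2
     in if den = 0 then \<infinity> else ereal (num / den))"

end

theory Submission
  imports Defs
begin

text \<open>
  Under \<open>\<V>\<^sub>X\<close> the BCD iteration becomes a Landweber--Kaczmarz iteration for the equations
  \<open>T\<^sub>b \<xi> = v\<^sub>b\<^sup>T y\<close> with \<open>T\<^sub>b = v\<^sub>b\<^sup>T \<otimes> K\<close>. In these coordinates the step size bound is exactly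
  what makes \<open>\<parallel>\<V>\<^sub>X (x\<^sub>k - z)\<parallel>\<^sup>2\<close> decrease by a multiple of the squared residual, for every solution
  \<open>z\<close>. The residuals are therefore square summable and the sequence is Cauchy; a left inverse of
  \<open>V\<close> transports convergence back. All increments are orthogonal to the kernel of \<open>\<A>\<close>, which
  consists of the blocks in the kernel of \<open>K\<close>, so the limit is the solution nearest to \<open>x\<^sub>0\<close>.
\<close>

section \<open>Riesz representation and adjoints on Hilbert spaces\<close>

text \<open>If \<open>w\<close> represents \<open>f\<close>, then
  \<open>J x = norm (x - w) ^ 2 - norm w ^ 2\<close>, so \<open>w\<close> has to be the minimiser of
  \<open>J\<close>. Conversely, completeness makes a minimising sequence converge, and stationarity
  of \<open>J\<close> at the limit is the representation.\<close>

lemma riesz_representation: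
  fixes f :: "'a::{real_inner,complete_space} \<Rightarrow> real"
  assumes "bounded_linear f"
  shows "\<exists>w. \<forall>x. f x = inner x w"
proof -
  interpret f: bounded_linear f by fact
  obtain c where c: "\<And>x. \<bar>f x\<bar> \<le> norm x * c"
    using f.bounded by (auto simp: real_norm_def)
  define J where "J x = (norm x)\<^sup>2 - 2 * f x" for x
  have lower: "- c\<^sup>2 \<le> J x" for x
  proof -
    have "0 \<le> (norm x - c)\<^sup>2" by simp
    moreover have "f x \<le> norm x * c" using c[of x] by simp
    ultimately show ?thesis by (simp add: J_def power2_diff)
  qed
  define m where "m = Inf (range J)"
  have bdd: "bdd_below (range J)" using lower by (auto intro!: bdd_belowI)
  have m_le: "m \<le> J x" for x
    unfolding m_def using bdd by (simp add: cInf_lower)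
  have "\<exists>x. J x < m + inverse (real (Suc n))" for n
  proof -
    have "Inf (range J) < m + inverse (real (Suc n))" by (simp add: m_def)
    then show ?thesis using cInf_lessD[of "range J"] by blast
  qed
  then obtain a where a: "\<And>n. J (a n) < m + inverse (real (Suc n))" by metis
  have J_lim: "(\<lambda>n. J (a n)) \<longlonglongrightarrow> m"
  proof (rule tendsto_sandwich)
    show "\<forall>\<^sub>F n in sequentially. m \<le> J (a n)" using m_le by simp
    show "\<forall>\<^sub>F n in sequentially. J (a n) \<le> m + inverse (real (Suc n))"
      using a by (simp add: less_imp_le)
    show "(\<lambda>n. m + inverse (real (Suc n))) \<longlonglongrightarrow> m"
      using tendsto_add[OF tendsto_const LIMSEQ_inverse_real_of_nat] by simp
  qed simp
  \<comment> \<open>Parallelogram identity: the linear parts cancel, and \<open>J\<close> at the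
    midpoint is at least \<open>m\<close>. Near-minimisers are therefore close to each
    other.\<close>
  have mid: "(norm (u - v))\<^sup>2 \<le> 2 * (J u - m) + 2 * (J v - m)" for u v
  proof -
    have "(norm (u - v))\<^sup>2 = 2 * J u + 2 * J v - 4 * J ((1/2) *\<^sub>R (u + v))"
      by (simp add: J_def power2_norm_eq_inner inner_add inner_diff inner_commute f.add f.scaleR
          algebra_simps)
    then show ?thesis using m_le[of "(1/2) *\<^sub>R (u + v)"] by simp
  qed
  have "Cauchy a"
  proof (rule metric_CauchyI)
    fix e :: real assume e: "e > 0"
    have "\<forall>\<^sub>F n in sequentially. J (a n) < m + e\<^sup>2 / 4"
      using J_lim by (rule order_tendstoD) (use e in simp)
    then obtain N where N: "\<And>n. n \<ge> N \<Longrightarrow> J (a n) < m + e\<^sup>2 / 4"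
      by (auto simp: eventually_sequentially)
    have "dist (a i) (a j) < e" if "i \<ge> N" "j \<ge> N" for i j
    proof (rule power2_less_imp_less)
      show "(dist (a i) (a j))\<^sup>2 < e\<^sup>2"
        using mid[of "a i" "a j"] N[OF that(1)] N[OF that(2)] by (simp add: dist_norm)
    qed (use e in simp)
    then show "\<exists>M. \<forall>i\<ge>M. \<forall>j\<ge>M. dist (a i) (a j) < e" by blast
  qed
  then obtain w where w: "a \<longlonglongrightarrow> w" using Cauchy_convergent_iff convergent_def by blast
  have "(\<lambda>n. J (a n)) \<longlonglongrightarrow> J w"
    unfolding J_def by (intro tendsto_intros f.tendsto w)
  with J_lim have Jw: "J w = m" using LIMSEQ_unique by blast
  have "f h = inner h w" for h
  proof (cases "h = 0")
    case True then show ?thesis by (simp add: f.zero)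
  next
    case False
    define d where "d = f h - inner h w"
    \<comment> \<open>The \<open>t\<close> that minimises the quadratic
      \<open>J (w + t *\<^sub>R h)\<close>; it lowers \<open>J\<close> by
      \<open>d\<^sup>2 / (norm h)\<^sup>2\<close>, which minimality of \<open>w\<close> forces to be
      0.\<close>
    define t where "t = d / (norm h)\<^sup>2"
    have "J (w + t *\<^sub>R h) = J w + t\<^sup>2 * (norm h)\<^sup>2 - 2 * t * d"
      by (simp add: J_def d_def power2_norm_eq_inner inner_add f.add f.scaleR inner_commute
          algebra_simps) (simp add: power2_eq_square)
    also have "\<dots> = J w - d\<^sup>2 / (norm h)\<^sup>2"
      using False by (simp add: t_def field_simps power2_eq_square)
    finally have "d\<^sup>2 / (norm h)\<^sup>2 \<le> 0" using m_le[of "w + t *\<^sub>R h"] Jw by simp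
    then show ?thesis using False by (simp add: d_def divide_le_0_iff)
  qed
  then show ?thesis by blast
qed

text \<open>\<open>adjoint\<close> is a choice operator, so it obeys the adjoint identity once some
  function does. Riesz, applied to the functionals \<open>inner (K x) y\<close> of \<open>x\<close>,
  provides one.\<close>

lemma adjoint_bounded_linear_inner:
  fixes K :: "'a::{real_inner,complete_space} \<Rightarrow> 'b::real_inner"
  assumes "bounded_linear K"
  shows "inner (K x) y = inner x (adjoint K y)"
proof -
  have "\<exists>w. \<forall>x. inner (K x) y = inner x w" for y
    by (rule riesz_representation)
      (rule bounded_linear_compose[OF bounded_linear_inner_left assms])
  then obtain g where g: "\<forall>x y. inner (K x) y = inner x (g y)" by metis
  then show ?thesis using adjoint_unique[OF g] by simp
qed

section \<open>Convergence of the abstract Landweber-Kaczmarz iteration\<close>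

text \<open>\<open>e\<close> is the error relative to a solution, which makes the equations
  homogeneous. \<open>step\<close> is the Landweber step in weak form, with the adjoint of
  \<open>T\<close> moved onto the test vector \<open>w\<close>; the step size rule enters through
  \<open>descent\<close>.\<close>

lemma landweber_kaczmarz_converges:
  fixes e :: "nat \<Rightarrow> 'h::{real_inner,complete_space}"
    and T :: "'i \<Rightarrow> 'h \<Rightarrow> 'y::real_inner"
  assumes T: "\<And>i. linear (T i)" "\<And>i w. norm (T i w) \<le> L * norm w" and L: "0 \<le> L"
    and control: "\<And>k. b ` {k..<k + p} = UNIV"
    and step: "\<And>k w. inner (e (Suc k) - e k) w = - s k * inner (T (b k) (e k)) (T (b k) w)"
    and s: "\<And>k. 0 \<le> s k" "\<And>k. s k \<le> M"
    and c: "0 < c"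
    and descent: "\<And>k. (norm (e (Suc k)))\<^sup>2 \<le> (norm (e k))\<^sup>2 - c * (norm (T (b k) (e k)))\<^sup>2"
  shows "\<exists>l. e \<longlonglongrightarrow> l \<and> (\<forall>i. T i l = 0)"
proof -
  define u where "u k = norm (T (b k) (e k))" for k
  \<comment> \<open>A full control cycle starts at \<open>k\<close>, so up to a constant
    \<open>S k\<close> dominates the residuals of all equations at \<open>e k\<close>, not only that
    of the active one.\<close>
  define S where "S k = (\<Sum>j<p. u (k + j))" for k
  have u0: "0 \<le> u k" for k by (simp add: u_def)
  have S0: "0 \<le> S k" for k by (simp add: S_def sum_nonneg u0)
  have M0: "0 \<le> M" using s[of 0] by linarith
  have p0: "0 < p" using control[of 0] by (cases p) auto
  have dec: "(norm (e l))\<^sup>2 \<le> (norm (e k))\<^sup>2" if "k \<le> l" for k l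
  proof (rule lift_Suc_antimono_le[OF _ that])
    show "(norm (e (Suc n)))\<^sup>2 \<le> (norm (e n))\<^sup>2" for n
      using descent[of n] c by (smt (verit) mult_nonneg_nonneg zero_le_power2)
  qed
  have conv_norm: "convergent (\<lambda>k. (norm (e k))\<^sup>2)"
  proof -
    have "decseq (\<lambda>k. (norm (e k))\<^sup>2)" using dec by (simp add: antimono_def)
    then show ?thesis by (metis convergentI decseq_convergent zero_le_power2)
  qed
  have "summable (\<lambda>k. c * (u k)\<^sup>2)"
  proof (rule summableI_nonneg_bounded)
    fix n
    have "(\<Sum>k<n. c * (u k)\<^sup>2) \<le> (norm (e 0))\<^sup>2 - (norm (e n))\<^sup>2"
    proof (induction n)
      case (Suc n) then show ?case using descent[of n] by (simp add: u_def)
    qed simp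
    then show "(\<Sum>k<n. c * (u k)\<^sup>2) \<le> (norm (e 0))\<^sup>2"
      by (smt (verit) zero_le_power2)
  qed (use c in simp)
  then have sum_u: "summable (\<lambda>k. (u k)\<^sup>2)" using c by (simp add: summable_cmult_iff)
  have sum_S: "summable (\<lambda>k. (S k)\<^sup>2)"
  proof (rule summable_comparison_test')
    show "summable (\<lambda>k. real p * (\<Sum>j<p. (u (k + j))\<^sup>2))"
      using sum_u by (intro summable_mult summable_sum summable_ignore_initial_segment)
    show "norm ((S k)\<^sup>2) \<le> real p * (\<Sum>j<p. (u (k + j))\<^sup>2)" for k
      using sum_squared_le_sum_of_squares[of "\<lambda>j. u (k + j)" "{..<p}"]
      by (simp add: S_def mult.commute)
  qed
  \<comment> \<open>The weak step is tested against the increment itself, and one factor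
    \<open>norm ?d\<close> is cancelled.\<close>
  have incr: "norm (e (Suc k) - e k) \<le> M * L * u k" for k
  proof -
    let ?d = "e (Suc k) - e k"
    have "(norm ?d)\<^sup>2 = s k * (- inner (T (b k) (e k)) (T (b k) ?d))"
      using step[of k ?d] by (simp add: power2_norm_eq_inner)
    also have "\<dots> \<le> s k * (u k * (L * norm ?d))"
    proof (rule mult_left_mono[OF _ s(1)])
      have "- inner (T (b k) (e k)) (T (b k) ?d) \<le> u k * norm (T (b k) ?d)"
        unfolding u_def using Cauchy_Schwarz_ineq2[of "T (b k) (e k)" "T (b k) ?d"] by linarith
      also have "\<dots> \<le> u k * (L * norm ?d)" by (rule mult_left_mono[OF T(2) u0])
      finally show "- inner (T (b k) (e k)) (T (b k) ?d) \<le> u k * (L * norm ?d)" .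
    qed
    also have "\<dots> \<le> M * (u k * (L * norm ?d))"
      by (rule mult_right_mono[OF s(2)]) (simp add: u0 L)
    finally have "norm ?d * norm ?d \<le> (M * L * u k) * norm ?d"
      by (simp add: power2_eq_square mult_ac)
    then show ?thesis
      using mult_nonneg_nonneg[OF mult_nonneg_nonneg[OF M0 L] u0]
      by (cases "norm ?d = 0") (auto simp: mult_le_cancel_right)
  qed
  have drift: "norm (e (k + n) - e k) \<le> M * L * (\<Sum>j<n. u (k + j))" for k n
  proof (induction n)
    case (Suc n)
    have "norm (e (k + Suc n) - e k) \<le> norm (e (Suc (k + n)) - e (k + n)) + norm (e (k + n) - e k)"
      using norm_triangle_ineq[of "e (Suc (k + n)) - e (k + n)" "e (k + n) - e k"] by simp
    then show ?case using Suc incr[of "k + n"] by (simp add: algebra_simps)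
  qed simp
  \<comment> \<open>The 1 pays for the residual of equation \<open>i\<close> at the time
    \<open>j\<close> in the cycle when it is active; \<open>L * (M * L)\<close> pays for applying
    \<open>T i\<close> to the drift from \<open>e k\<close> to \<open>e j\<close>.\<close>
  define C where "C = 1 + L * (M * L)"
  have C0: "0 \<le> C" using L M0 by (simp add: C_def)
  have Te: "norm (T i (e k)) \<le> C * S k" for i k
  proof -
    have "i \<in> b ` {k..<k + p}" by (simp add: control)
    then obtain j where j: "k \<le> j" "j < k + p" and bj: "b j = i" by auto
    define n where "n = j - k"
    have n: "j = k + n" "n < p" using j by (auto simp: n_def)
    interpret Ti: linear "T i" by (rule T)
    have "T i (e k) = T i (e j) - T i (e j - e k)" by (simp add: Ti.diff)
    then have "norm (T i (e k)) \<le> norm (T i (e j)) + norm (T i (e j - e k))"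
      by (metis norm_triangle_ineq4)
    also have "norm (T i (e j)) = u j" by (simp add: u_def bj)
    also have "u j \<le> S k"
      unfolding S_def n using member_le_sum[of n "{..<p}" "\<lambda>j. u (k + j)"] n(2) u0 by simp
    also have "norm (T i (e j - e k)) \<le> L * (M * L * (\<Sum>j<n. u (k + j)))"
      using T(2) drift[of k n] L unfolding n by (meson mult_left_mono order_trans)
    also have "\<dots> \<le> L * (M * L * S k)"
      unfolding S_def using n(2) L M0 u0 by (intro mult_left_mono sum_mono2) auto
    finally show ?thesis by (simp add: C_def algebra_simps)
  qed
  \<comment> \<open>Norms are taken only after testing with \<open>w\<close>, so residuals of
    \<open>w\<close> survive as factors. For \<open>w = e n\<close> each term is a product of two
    residuals; \<open>drift\<close> alone would leave first powers of \<open>u j\<close>, whereas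
    only their squares are known to be summable.\<close>
  have cross: "\<bar>inner (e (k + n) - e k) w\<bar> \<le> (\<Sum>j=k..<k + n. M * (u j * norm (T (b j) w)))" for k n w
  proof (induction n)
    case (Suc n)
    have "\<bar>inner (e (Suc (k + n)) - e (k + n)) w\<bar>
        = s (k + n) * \<bar>inner (T (b (k + n)) (e (k + n))) (T (b (k + n)) w)\<bar>"
      using s(1)[of "k + n"] by (simp add: step abs_mult)
    also have "\<dots> \<le> M * (u (k + n) * norm (T (b (k + n)) w))"
      unfolding u_def by (intro mult_mono s Cauchy_Schwarz_ineq2 M0) auto
    finally show ?case using Suc by (simp add: inner_diff_left)
  qed simp
  \<comment> \<open>A convergent scalar sequence whose differences dominate the squared distances.
    The two legs through the pivot cost \<open>2 * (M * C * Q)\<close> each, and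
    \<open>(a + b)\<^sup>2 \<le> 2 * a\<^sup>2 + 2 * b\<^sup>2\<close> doubles everything: hence the
    2 and the 8.\<close>
  define F where "F k = 2 * (norm (e k))\<^sup>2 - 8 * (M * C) * (\<Sum>j<k. (S j)\<^sup>2)" for k
  have FC: "(norm (e l - e k))\<^sup>2 \<le> F k - F l" if kl: "k \<le> l" for k l
  proof -
    \<comment> \<open>The pivot index \<open>n\<close> minimises the residual over a full cycle, so that the cross terms
      are controlled by the summable sequence of squared residuals.\<close>
    have "Min (S ` {k..l}) \<in> S ` {k..l}" using kl by (intro Min_in) auto
    then obtain n where n: "n \<in> {k..l}" and Sn: "S n = Min (S ` {k..l})" by (metis imageE)
    have min: "S n \<le> S j" if "j \<in> {k..l}" for j
      unfolding Sn using that by (intro Min_le) auto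
    define Q where "Q = (\<Sum>j=k..<l. (S j)\<^sup>2)"
    have bnd: "M * (u j * norm (T (b j) (e n))) \<le> M * C * (S j)\<^sup>2" if j: "j \<in> {k..<l}" for j
    proof -
      have uS: "u j \<le> S j"
        unfolding S_def using member_le_sum[of 0 "{..<p}" "\<lambda>i. u (j + i)"] p0 u0 by simp
      have "norm (T (b j) (e n)) \<le> C * S j"
        using Te[of "b j" n] mult_left_mono[OF min[of j] C0] j by auto
      then have "u j * norm (T (b j) (e n)) \<le> S j * (C * S j)"
        by (intro mult_mono uS S0) auto
      then have "M * (u j * norm (T (b j) (e n))) \<le> M * (S j * (C * S j))"
        by (rule mult_left_mono[OF _ M0])
      then show ?thesis by (simp add: power2_eq_square mult_ac)
    qed
    have part: "\<bar>inner (e d - e a) (e n)\<bar> \<le> M * C * Q" if "k \<le> a" "a \<le> d" "d \<le> l" for a d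
    proof -
      have "\<bar>inner (e d - e a) (e n)\<bar> \<le> (\<Sum>j=a..<d. M * (u j * norm (T (b j) (e n))))"
        using cross[of a "d - a" "e n"] that by simp
      also have "\<dots> \<le> (\<Sum>j=a..<d. M * C * (S j)\<^sup>2)"
        using that by (intro sum_mono bnd) auto
      also have "\<dots> \<le> (\<Sum>j=k..<l. M * C * (S j)\<^sup>2)"
        using that M0 C0 by (intro sum_mono2) auto
      finally show ?thesis by (simp add: Q_def sum_distrib_left)
    qed
    \<comment> \<open>In the expansion around \<open>e n\<close>, the difference of squared norms is
      nonpositive by \<open>dec\<close>, so only the cross term remains.\<close>
    have 1: "(norm (e l - e n))\<^sup>2 \<le> 2 * (M * C * Q)"
    proof -
      have "(norm (e l - e n))\<^sup>2 = (norm (e l))\<^sup>2 - (norm (e n))\<^sup>2 - 2 * inner (e l - e n) (e n)"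
        by (simp add: power2_norm_eq_inner inner_diff inner_commute algebra_simps)
      moreover have "\<bar>inner (e l - e n) (e n)\<bar> \<le> M * C * Q" by (rule part) (use n in auto)
      moreover have "(norm (e l))\<^sup>2 \<le> (norm (e n))\<^sup>2" by (rule dec) (use n in auto)
      ultimately show ?thesis by linarith
    qed
    have 2: "(norm (e n - e k))\<^sup>2 \<le> (norm (e k))\<^sup>2 - (norm (e l))\<^sup>2 + 2 * (M * C * Q)"
    proof -
      have "(norm (e n - e k))\<^sup>2 = (norm (e k))\<^sup>2 - (norm (e n))\<^sup>2 + 2 * inner (e n - e k) (e n)"
        by (simp add: power2_norm_eq_inner inner_diff inner_commute algebra_simps)
      moreover have "\<bar>inner (e n - e k) (e n)\<bar> \<le> M * C * Q" by (rule part) (use n in auto)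
      moreover have "(norm (e l))\<^sup>2 \<le> (norm (e n))\<^sup>2" by (rule dec) (use n in auto)
      ultimately show ?thesis by linarith
    qed
    have "norm (e l - e k) \<le> norm (e l - e n) + norm (e n - e k)"
      using norm_triangle_ineq[of "e l - e n" "e n - e k"] by simp
    then have "(norm (e l - e k))\<^sup>2 \<le> (norm (e l - e n) + norm (e n - e k))\<^sup>2"
      by (simp add: power_mono)
    also have "\<dots> \<le> 2 * (norm (e l - e n))\<^sup>2 + 2 * (norm (e n - e k))\<^sup>2"
      using sum_squares_bound[of "norm (e l - e n)" "norm (e n - e k)"]
      by (simp add: power2_sum)
    finally have "(norm (e l - e k))\<^sup>2 \<le> 2 * (norm (e k))\<^sup>2 - 2 * (norm (e l))\<^sup>2 + 8 * (M * C * Q)"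
      using 1 2 by linarith
    moreover have "(\<Sum>j<l. (S j)\<^sup>2) = (\<Sum>j<k. (S j)\<^sup>2) + Q"
      unfolding Q_def using kl sum.atLeastLessThan_concat[of 0 k l "\<lambda>j. (S j)\<^sup>2"]
      by (simp add: lessThan_atLeast0)
    ultimately show ?thesis by (simp add: F_def algebra_simps)
  qed
  have "convergent F"
    unfolding F_def using conv_norm sum_S
    by (intro convergent_diff convergent_mult_const_iff[THEN iffD2] convergent_mult convergent_const)
       (simp_all add: summable_iff_convergent)
  then have "Cauchy F" by (simp add: Cauchy_convergent_iff)
  have "Cauchy e"
  proof (rule CauchyI')
    fix \<epsilon> :: real assume \<epsilon>: "\<epsilon> > 0"
    then obtain N where N: "\<And>k l. k \<ge> N \<Longrightarrow> l \<ge> N \<Longrightarrow> dist (F k) (F l) < \<epsilon>\<^sup>2"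
      using \<open>Cauchy F\<close> unfolding Cauchy_def by (metis zero_less_power)
    have "dist (e k) (e l) < \<epsilon>" if "k \<ge> N" "k < l" for k l
    proof (rule power2_less_imp_less)
      have "F k - F l < \<epsilon>\<^sup>2" using N[of k l] that by (simp add: dist_real_def)
      then show "(dist (e k) (e l))\<^sup>2 < \<epsilon>\<^sup>2"
        using FC[of k l] that by (simp add: dist_norm norm_minus_commute)
    qed (use \<epsilon> in simp)
    then show "\<exists>M. \<forall>m\<ge>M. \<forall>n>m. dist (e m) (e n) < \<epsilon>" by blast
  qed
  then obtain l where l: "e \<longlonglongrightarrow> l" using Cauchy_convergent_iff convergent_def by blast
  have "T i l = 0" for i
  proof -
    have bl: "bounded_linear (T i)"
      using T by (intro bounded_linear.intro bounded_linear_axioms.intro) (auto simp: mult.commute)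
    have "(\<lambda>k. (S k)\<^sup>2) \<longlonglongrightarrow> 0" using sum_S by (rule summable_LIMSEQ_zero)
    then have "S \<longlonglongrightarrow> 0" using tendsto_real_sqrt[of "\<lambda>k. (S k)\<^sup>2" 0] S0 by simp
    then have "(\<lambda>k. C * S k) \<longlonglongrightarrow> 0" by (rule tendsto_mult_right_zero)
    then have "(\<lambda>k. T i (e k)) \<longlonglongrightarrow> 0" by (rule Lim_null_comparison[rotated]) (simp add: Te)
    moreover have "(\<lambda>k. T i (e k)) \<longlonglongrightarrow> T i l" by (rule bounded_linear.tendsto[OF bl l])
    ultimately show ?thesis using LIMSEQ_unique by blast
  qed
  with l show ?thesis by blast
qed

section \<open>Calculus of the operators \<open>V \<otimes>\<^sub>M T\<close>\<close>

lemma mat_tensor_nth: "(V \<otimes>\<^sub>M T) x $ d = (\<Sum>b\<in>UNIV. V $ d $ b *\<^sub>R T (x $ b))"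
  by (simp add: mat_tensor_def)

lemma linear_mat_tensor:
  assumes "linear T"
  shows "linear (V \<otimes>\<^sub>M T)"
proof -
  interpret linear T by fact
  show ?thesis
    by (intro linearI)
      (simp_all add: vec_eq_iff mat_tensor_nth add scale scaleR_add_right sum.distrib
        scaleR_sum_right mult.commute)
qed

lemma bounded_linear_mat_tensor:
  fixes T :: "'x::real_normed_vector \<Rightarrow> 'y::real_normed_vector" and V :: "real ^ 'b ^ 'd"
  assumes "bounded_linear T"
  shows "bounded_linear (V \<otimes>\<^sub>M T)"
proof -
  interpret T: bounded_linear T by fact
  interpret VT: linear "V \<otimes>\<^sub>M T" by (rule linear_mat_tensor) (rule T.linear)
  obtain c where c: "0 < c" "\<And>x. norm (T x) \<le> norm x * c" using T.pos_bounded by auto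
  show ?thesis
  proof (rule bounded_linear_intro)
    fix x :: "'x ^ 'b"
    have "norm ((V \<otimes>\<^sub>M T) x) \<le> (\<Sum>d\<in>UNIV. norm ((V \<otimes>\<^sub>M T) x $ d))"
      by (simp add: norm_vec_def L2_set_le_sum)
    also have "\<dots> \<le> (\<Sum>d\<in>UNIV. \<Sum>b\<in>UNIV. \<bar>V $ d $ b\<bar> * (norm x * c))"
    proof (rule sum_mono)
      fix d
      have "norm (V $ d $ b *\<^sub>R T (x $ b)) \<le> \<bar>V $ d $ b\<bar> * (norm x * c)" for b
        using order_trans[OF c(2) mult_right_mono[OF Finite_Cartesian_Product.norm_nth_le[of x b]]] c(1)
        by (simp add: mult_left_mono)
      then show "norm ((V \<otimes>\<^sub>M T) x $ d) \<le> (\<Sum>b\<in>UNIV. \<bar>V $ d $ b\<bar> * (norm x * c))"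
        unfolding mat_tensor_nth by (intro sum_norm_le) auto
    qed
    finally show "norm ((V \<otimes>\<^sub>M T) x) \<le> norm x * (\<Sum>d\<in>UNIV. \<Sum>b\<in>UNIV. \<bar>V $ d $ b\<bar> * c)"
      by (simp add: sum_distrib_left mult_ac)
  qed (simp_all add: VT.add VT.scale)
qed

text \<open>Mixed product rule. It commutes matrix factors past \<open>K\<close> and lets a left
  inverse of \<open>V\<close> undo the tensor operator.\<close>

lemma mat_tensor_compose:
  fixes W :: "real ^ 'd ^ 'e" and V :: "real ^ 'b ^ 'd"
  assumes "linear S"
  shows "(W \<otimes>\<^sub>M S) ((V \<otimes>\<^sub>M T) x) = ((W ** V) \<otimes>\<^sub>M (S \<circ> T)) x"
proof -
  interpret linear S by fact
  have "(\<Sum>d\<in>UNIV. W $ i $ d *\<^sub>R S (\<Sum>b\<in>UNIV. V $ d $ b *\<^sub>R T (x $ b)))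
      = (\<Sum>b\<in>UNIV. (\<Sum>d\<in>UNIV. W $ i $ d * V $ d $ b) *\<^sub>R S (T (x $ b)))" for i
    by (simp add: sum scale scaleR_sum_right scaleR_sum_left) (rule sum.swap)
  then show ?thesis by (simp add: vec_eq_iff mat_tensor_nth matrix_matrix_mult_def)
qed

lemma mat_tensor_mat_1: "(mat 1 \<otimes>\<^sub>M T) x $ i = T (x $ i)"
proof -
  have "(mat 1 \<otimes>\<^sub>M T) x $ i = (\<Sum>b\<in>UNIV. if i = b then T (x $ b) else 0)"
    unfolding mat_tensor_nth mat_def by (rule sum.cong) auto
  then show ?thesis by simp
qed

lemma inner_mat_tensor:
  assumes "\<And>x y. inner (T x) y = inner x (T' y)"
  shows "inner ((V \<otimes>\<^sub>M T) x) y = inner x ((transpose V \<otimes>\<^sub>M T') y)"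
proof -
  have "inner ((V \<otimes>\<^sub>M T) x) y = (\<Sum>d\<in>UNIV. \<Sum>b\<in>UNIV. V $ d $ b * inner (x $ b) (T' (y $ d)))"
    by (simp add: inner_vec_def mat_tensor_nth inner_sum_left assms)
  also have "\<dots> = (\<Sum>b\<in>UNIV. \<Sum>d\<in>UNIV. V $ d $ b * inner (x $ b) (T' (y $ d)))"
    by (rule sum.swap)
  also have "\<dots> = inner x ((transpose V \<otimes>\<^sub>M T') y)"
    by (simp add: inner_vec_def mat_tensor_nth inner_sum_right transpose_def)
  finally show ?thesis .
qed

lemma adjoint_mat_tensor:
  assumes "\<And>x y. inner (T x) y = inner x (T' y)"
  shows "adjoint (V \<otimes>\<^sub>M T) = transpose V \<otimes>\<^sub>M T'"
  by (rule adjoint_unique) (simp add: inner_mat_tensor[OF assms])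

lemma linear_adjoint:
  assumes "\<And>x y. inner (T x) y = inner x (T' y)"
  shows "linear T'"
  by (rule linearI; rule vector_eq_ldot[THEN iffD1])
    (simp_all add: inner_add_right assms[symmetric])

lemma mat_tensor_block_proj:
  assumes "T 0 = 0"
  shows "(V \<otimes>\<^sub>M T) (block_proj b x) = (\<chi> d. V $ d $ b *\<^sub>R T (x $ b))"
proof -
  have "(\<Sum>i\<in>UNIV. V $ d $ i *\<^sub>R T (block_proj b x $ i))
      = (\<Sum>i\<in>UNIV. if i = b then V $ d $ b *\<^sub>R T (x $ b) else 0)" for d
    by (rule sum.cong) (auto simp: block_proj_def assms)
  then show ?thesis by (simp add: vec_eq_iff mat_tensor_nth)
qed

section \<open>The step size bound in terms of the column residual\<close>

lemma norm_column_tensor: "norm (\<chi> d. V $ d $ b *\<^sub>R h) = norm (column b V) * norm h"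
  by (simp add: norm_vec_def column_def L2_set_left_distrib)

lemma col_proj_eq:
  "col_proj V b r = (inverse ((norm (column b V))\<^sup>2)) *\<^sub>R
     (\<chi> d. V $ d $ b *\<^sub>R ((transpose V \<otimes>\<^sub>M id) r $ b))"
  by (simp add: vec_eq_iff col_proj_def outer_prod_def column_def mat_tensor_nth transpose_def
      scaleR_sum_right mult.assoc)

text \<open>With \<open>v\<close> the column \<open>b\<close> of \<open>V\<close>, the projection of
  \<open>r\<close> is \<open>v\<close> times \<open>u r b\<close> over the squared norm of
  \<open>v\<close>, so the column norm cancels in the numerator. The denominator is the squared norm
  of \<open>v\<close> tensored with \<open>K' (u r b)\<close>. A zero column falls into the infinite
  branch.\<close>

lemma step_bound_eq:
  fixes K :: "'x::real_inner \<Rightarrow> 'y::real_inner" and V :: "real ^ 'b ^ 'd"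
  assumes adj: "\<And>x y. inner (K x) y = inner x (K' y)"
  defines "u \<equiv> \<lambda>r b. (transpose V \<otimes>\<^sub>M id) r $ b"
  shows "step_bound V K b r =
    (if norm (column b V) * norm (K' (u r b)) = 0 then \<infinity>
     else ereal ((norm (u r b))\<^sup>2 / (norm (column b V) * norm (K' (u r b)))\<^sup>2))"
proof -
  interpret K': linear K' by (rule linear_adjoint[OF adj])
  have "adjoint (V \<otimes>\<^sub>M K) r $ b = K' (u r b)"
    by (simp add: adjoint_mat_tensor[OF adj] mat_tensor_nth u_def K'.sum K'.scale)
  then have den: "norm ((V \<otimes>\<^sub>M id) (block_proj b (adjoint (V \<otimes>\<^sub>M K) r)))
      = norm (column b V) * norm (K' (u r b))"
    by (simp add: mat_tensor_block_proj norm_column_tensor)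
  have num: "(norm (column b V))\<^sup>2 * (norm (col_proj V b r))\<^sup>2 = (norm (u r b))\<^sup>2"
    if "norm (column b V) \<noteq> 0"
    using that by (simp add: col_proj_eq norm_column_tensor u_def field_simps power2_eq_square)
  show ?thesis
    using num by (auto simp: step_bound_def Let_def den)
qed

text \<open>The relaxation bound with denominators cleared, which is the form used in the descent
  estimate and covers an infinite step bound too.\<close>

lemma step_bound_ratio_le:
  fixes K :: "'x::real_inner \<Rightarrow> 'y::real_inner" and V :: "real ^ 'b ^ 'd"
  assumes adj: "\<And>x y. inner (K x) y = inner x (K' y)"
    and le: "ereal s / step_bound V K b r \<le> ereal \<theta>"
  defines "u \<equiv> (transpose V \<otimes>\<^sub>M id) r $ b"
  shows "s * (norm (column b V) * norm (K' u))\<^sup>2 \<le> \<theta> * (norm u)\<^sup>2"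
proof (cases "norm (column b V) * norm (K' u) = 0")
  case True
  \<comment> \<open>Here the step bound is \<open>\<infinity>\<close> and the quotient is 0 by
    convention, so the hypothesis yields just the sign of \<open>\<theta>\<close>.\<close>
  then have "0 \<le> \<theta>" using le step_bound_eq[OF adj, of V b r] by (simp add: u_def zero_ereal_def)
  then show ?thesis unfolding True by simp
next
  case False
  interpret K': linear K' by (rule linear_adjoint[OF adj])
  \<comment> \<open>Makes the step bound strictly positive, so that the division by it can be
    cleared.\<close>
  have "u \<noteq> 0" using False K'.zero by auto
  moreover have "step_bound V K b r = ereal ((norm u)\<^sup>2 / (norm (column b V) * norm (K' u))\<^sup>2)"
    using False step_bound_eq[OF adj, of V b r] by (simp add: u_def)
  ultimately show ?thesis using le False by (simp add: field_simps)
qed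

section \<open>Convergence of the block iteration to the nearest solution\<close>

theorem theorem3p1:
  fixes K :: "'x::{real_inner,complete_space} \<Rightarrow> 'y::{real_inner,complete_space}"
    and V :: "real ^ 'b ^ 'd"
    and b :: "nat \<Rightarrow> 'b"
    and p :: nat
    and y :: "'y ^ 'd"
    and x\<^sub>0 :: "'x ^ 'b"
    and x :: "nat \<Rightarrow> 'x ^ 'b"
    and s :: "nat \<Rightarrow> real"
    and s_min s_max \<theta>_max :: real
  assumes "bounded_linear K"
    and "rank V = CARD('b)"
    and "p \<ge> 1"
    and "\<And>k. b ` {k..k + p - 1} = UNIV"
    and "\<exists>z. (V \<otimes>\<^sub>M K) z = y"
    and "x 0 = x\<^sub>0"
    and "\<And>k. x (Suc k) =
           x k - s k *\<^sub>R block_proj (b k) (adjoint (V \<otimes>\<^sub>M K) ((V \<otimes>\<^sub>M K) (x k) - y))"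
    and "0 < s_min" and "s_min \<le> s_max" and "\<theta>_max < 2"
    and "\<And>k. s_min \<le> s k \<and> s k \<le> s_max"
    and "\<And>k. 0 < s k \<and> ereal (s k) < 2 * step_bound V K (b k) (y - (V \<otimes>\<^sub>M K) (x k))"
    and "\<And>k. ereal (s k) / step_bound V K (b k) (y - (V \<otimes>\<^sub>M K) (x k)) \<le> ereal \<theta>_max"
  shows "\<exists>x_plus.
           (\<forall>z. is_arg_min (\<lambda>u. dist u x\<^sub>0) (\<lambda>u. (V \<otimes>\<^sub>M K) u = y) z \<longleftrightarrow> z = x_plus) \<and>
           x \<longlonglongrightarrow> x_plus"
proof -
  let ?A = "V \<otimes>\<^sub>M K"
  let ?K = "adjoint K"
  let ?T = "\<lambda>i w. (transpose V \<otimes>\<^sub>M K) w $ i"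
  interpret K: bounded_linear K by fact
  interpret A: bounded_linear ?A by (rule bounded_linear_mat_tensor) fact
  have adj: "inner (K u) v = inner u (?K v)" for u v
    by (rule adjoint_bounded_linear_inner) fact
  interpret K': linear ?K by (rule linear_adjoint[OF adj])
  have id: "bounded_linear (id :: 'x \<Rightarrow> 'x)" by (simp add: bounded_linear_ident id_def)
  interpret VX: bounded_linear "V \<otimes>\<^sub>M (id :: 'x \<Rightarrow> 'x)"
    by (rule bounded_linear_mat_tensor[OF id])
  interpret VT: linear "transpose V \<otimes>\<^sub>M (id :: 'y \<Rightarrow> 'y)"
    by (rule linear_mat_tensor) (simp add: linear_id)
  interpret TT: bounded_linear "transpose V \<otimes>\<^sub>M K" by (rule bounded_linear_mat_tensor) fact
  obtain W :: "real ^ 'd ^ 'b" where W: "W ** V = mat 1"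
    using assms(2) full_rank_injective matrix_left_invertible_injective by blast
  obtain z where z: "?A z = y" using assms(5) by blast

  define e where "e k = (V \<otimes>\<^sub>M id) (x k - z)" for k
  \<comment> \<open>Both sides are the transpose of \<open>V\<close> times \<open>V\<close>,
    tensored with \<open>K\<close>: the matrix factor may act before or after
    \<open>K\<close>.\<close>
  have T_e: "?T i (e k) = (transpose V \<otimes>\<^sub>M id) (?A (x k) - y) $ i" for i k
  proof -
    have "(transpose V \<otimes>\<^sub>M K) (e k) = (transpose V \<otimes>\<^sub>M id) (?A (x k - z))"
      by (simp add: e_def mat_tensor_compose K.linear linear_id)
    then show ?thesis by (simp add: A.diff z)
  qed
  have grad: "adjoint ?A (?A (x k) - y) $ i = ?K (?T i (e k))" for i k
    unfolding T_e by (simp add: adjoint_mat_tensor[OF adj] mat_tensor_nth K'.sum K'.scale)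
  have e_step: "e (Suc k) - e k = - s k *\<^sub>R (\<chi> d. V $ d $ b k *\<^sub>R ?K (?T (b k) (e k)))" for k
  proof -
    have "e (Suc k) - e k = - s k *\<^sub>R (V \<otimes>\<^sub>M id) (block_proj (b k) (adjoint ?A (?A (x k) - y)))"
      by (simp add: e_def assms(7)[of k] VX.diff VX.scaleR)
    then show ?thesis by (simp add: mat_tensor_block_proj grad)
  qed
  \<comment> \<open>Column \<open>i\<close> tensored with \<open>?K\<close> is the adjoint of
    \<open>?T i\<close>, so \<open>e_step\<close> is a Landweber step for the active
    equation.\<close>
  have col: "inner (\<chi> d. V $ d $ i *\<^sub>R ?K v) w = inner v (?T i w)" for i v and w :: "'x ^ 'd"
    by (simp add: inner_vec_def mat_tensor_nth transpose_def inner_sum_right adj[symmetric]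
        inner_commute K.scaleR)
  have step: "inner (e (Suc k) - e k) w = - s k * inner (?T (b k) (e k)) (?T (b k) w)" for k w
    unfolding e_step by (simp add: col)
  \<comment> \<open>The squared error changes by \<open>- 2 * s k * (norm ?t)\<^sup>2\<close> plus
    the squared increment. The latter is at most
    \<open>s k * \<theta>_max * (norm ?t)\<^sup>2\<close>, which leaves a decrease with factor
    \<open>s k * (2 - \<theta>_max)\<close>.\<close>
  define c where "c = s_min * (2 - \<theta>_max)"
  have descent: "(norm (e (Suc k)))\<^sup>2 \<le> (norm (e k))\<^sup>2 - c * (norm (?T (b k) (e k)))\<^sup>2" for k
  proof -
    let ?t = "?T (b k) (e k)" and ?d = "e (Suc k) - e k"
    let ?n = "norm (column (b k) V) * norm (?K ?t)"
    have res: "(transpose V \<otimes>\<^sub>M id) (y - ?A (x k)) $ b k = - ?t"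
      unfolding T_e by (simp add: VT.diff)
    have "s k * ?n\<^sup>2 \<le> \<theta>_max * (norm ?t)\<^sup>2"
      using step_bound_ratio_le[OF adj assms(13)[of k]] by (simp add: res K'.neg)
    then have "s k * (s k * ?n\<^sup>2) \<le> s k * (\<theta>_max * (norm ?t)\<^sup>2)"
      using assms(12)[of k] by (intro mult_left_mono) auto
    moreover have "(norm ?d)\<^sup>2 = s k * (s k * ?n\<^sup>2)"
      unfolding e_step by (simp add: norm_column_tensor power_mult_distrib power2_eq_square mult_ac)
    moreover have "(norm (e (Suc k)))\<^sup>2 = (norm (e k))\<^sup>2 + 2 * inner ?d (e k) + (norm ?d)\<^sup>2"
      by (simp add: power2_norm_eq_inner inner_diff inner_commute algebra_simps)
    moreover have "inner ?d (e k) = - s k * (norm ?t)\<^sup>2"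
      by (simp add: step power2_norm_eq_inner)
    moreover have "c * (norm ?t)\<^sup>2 \<le> s k * (2 - \<theta>_max) * (norm ?t)\<^sup>2"
      unfolding c_def using assms(10) assms(11)[of k] by (intro mult_right_mono) auto
    ultimately show ?thesis by (simp add: algebra_simps)
  qed
  obtain L where L: "0 < L" "\<And>w. norm ((transpose V \<otimes>\<^sub>M K) w) \<le> norm w * L"
    using TT.pos_bounded by blast
  have "\<exists>l. e \<longlonglongrightarrow> l \<and> (\<forall>i. ?T i l = 0)"
  proof (rule landweber_kaczmarz_converges)
    show "linear (?T i)" for i by (rule linearI) (simp_all add: TT.add TT.scaleR)
    show "norm (?T i w) \<le> L * norm w" for i w
      using L(2)[of w] Finite_Cartesian_Product.norm_nth_le[of "(transpose V \<otimes>\<^sub>M K) w" i]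
      by (simp add: mult.commute)
    show "b ` {k..<k + p} = UNIV" for k
    proof -
      \<comment> \<open>Truncated subtraction is harmless since \<open>p \<ge> 1\<close>.\<close>
      have "{k..<k + p} = {k..k + p - 1}" using assms(3) by auto
      then show ?thesis using assms(4)[of k] by simp
    qed
    show "0 < c" using assms(8,10) by (simp add: c_def)
    show "0 \<le> s k" for k using assms(12)[of k] by simp
    show "s k \<le> s_max" for k using assms(11)[of k] by simp
  qed (use L step descent in auto)
  then obtain l where l: "e \<longlonglongrightarrow> l" and Tl: "\<And>i. ?T i l = 0" by blast

  have WV: "(W \<otimes>\<^sub>M id) ((V \<otimes>\<^sub>M T) u) $ i = T (u $ i)"
    for T :: "'x \<Rightarrow> 'z::real_vector" and u :: "'x ^ 'b" and i
    by (simp add: mat_tensor_compose linear_id W mat_tensor_mat_1)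
  define xp where "xp = z + (W \<otimes>\<^sub>M id) l"
  have x_lim: "x \<longlonglongrightarrow> xp"
  proof -
    have "(\<lambda>k. z + (W \<otimes>\<^sub>M id) (e k)) \<longlonglongrightarrow> xp"
      unfolding xp_def
      by (intro tendsto_intros bounded_linear.tendsto[OF bounded_linear_mat_tensor[OF id] l])
    moreover have "z + (W \<otimes>\<^sub>M id) (e k) = x k" for k by (simp add: e_def vec_eq_iff WV)
    ultimately show ?thesis by simp
  qed
  \<comment> \<open>The limit stays in the range of \<open>V \<otimes>\<^sub>M id\<close>, so the
    vanishing of all \<open>?T i l\<close> becomes a statement about
    \<open>?A (xp - z)\<close>.\<close>
  have "l = (V \<otimes>\<^sub>M id) (xp - z)"
  proof (rule LIMSEQ_unique[OF l])
    show "e \<longlonglongrightarrow> (V \<otimes>\<^sub>M id) (xp - z)"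
      unfolding e_def by (intro VX.tendsto tendsto_intros x_lim)
  qed
  then have "(transpose V \<otimes>\<^sub>M K) l = (transpose V \<otimes>\<^sub>M id) (?A (xp - z))"
    by (simp add: mat_tensor_compose K.linear linear_id)
  then have normal: "(transpose V \<otimes>\<^sub>M id) (?A (xp - z)) = 0"
    using Tl by (simp add: vec_eq_iff)
  \<comment> \<open>Applying \<open>?K\<close> blockwise turns \<open>normal\<close> into the normal
    equation for \<open>xp - z\<close>; pairing it with \<open>xp - z\<close> gives
    \<open>?A (xp - z) = 0\<close>.\<close>
  have sol: "?A xp = y"
  proof -
    have "(transpose V \<otimes>\<^sub>M ?K) (?A (xp - z)) $ i = ?K ((transpose V \<otimes>\<^sub>M id) (?A (xp - z)) $ i)" for i
      by (simp add: mat_tensor_nth K'.sum K'.scale)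
    then have "(transpose V \<otimes>\<^sub>M ?K) (?A (xp - z)) = 0"
      by (simp add: normal vec_eq_iff K'.zero)
    then have "inner (?A (xp - z)) (?A (xp - z)) = 0"
      by (simp add: inner_mat_tensor[OF adj])
    then show ?thesis by (simp add: A.diff z)
  qed
  \<comment> \<open>A block projection can leave the range of the adjoint of \<open>?A\<close>, so
    orthogonality is shown block by block: the left inverse \<open>W\<close> puts every block of
    \<open>h\<close> in the kernel of \<open>K\<close>, and every block of an increment is in the
    range of \<open>?K\<close>.\<close>
  have orth: "inner (xp - x\<^sub>0) h = 0" if h: "?A h = 0" for h
  proof -
    interpret WY: linear "W \<otimes>\<^sub>M (id :: 'y \<Rightarrow> 'y)"
      by (rule linear_mat_tensor) (simp add: linear_id)
    have Kh: "K (h $ i) = 0" for i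
      using WV[of K h i] by (simp add: h WY.zero)
    have "inner (block_proj i (adjoint ?A r)) h = 0" for i r
    proof -
      have "adjoint ?A r $ j = ?K ((transpose V \<otimes>\<^sub>M id) r $ j)" for j
        by (simp add: adjoint_mat_tensor[OF adj] mat_tensor_nth K'.sum K'.scale)
      then show ?thesis
        by (auto simp: inner_vec_def block_proj_def inner_commute[of "?K _"] adj[symmetric] Kh
            intro!: sum.neutral)
    qed
    then have "inner (x k - x\<^sub>0) h = 0" for k
      by (induction k) (simp_all add: assms(6,7) inner_diff_left)
    moreover have "(\<lambda>k. inner (x k - x\<^sub>0) h) \<longlonglongrightarrow> inner (xp - x\<^sub>0) h"
      by (intro tendsto_intros x_lim)
    ultimately show ?thesis by (simp add: LIMSEQ_const_iff)
  qed
  \<comment> \<open>Two solutions differ by a kernel element, orthogonal to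
    \<open>xp - x\<^sub>0\<close>. The identity gives minimality and uniqueness at once.\<close>
  have pyth: "(dist u x\<^sub>0)\<^sup>2 = (dist xp x\<^sub>0)\<^sup>2 + (dist u xp)\<^sup>2" if "?A u = y" for u
  proof -
    have "inner (xp - x\<^sub>0) (u - xp) = 0" by (rule orth) (simp add: A.diff that sol)
    then show ?thesis
      by (simp add: dist_norm power2_norm_eq_inner inner_diff inner_commute algebra_simps)
  qed
  have "is_arg_min (\<lambda>u. dist u x\<^sub>0) (\<lambda>u. ?A u = y) u \<longleftrightarrow> u = xp" for u
  proof
    assume "is_arg_min (\<lambda>u. dist u x\<^sub>0) (\<lambda>u. ?A u = y) u"
    then have u: "?A u = y" "dist u x\<^sub>0 \<le> dist xp x\<^sub>0"
      using sol by (auto simp: is_arg_min_def not_less)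
    have "(dist u x\<^sub>0)\<^sup>2 \<le> (dist xp x\<^sub>0)\<^sup>2" using u(2) by (intro power_mono) auto
    then show "u = xp" using pyth[OF u(1)] by simp
  next
    assume "u = xp"
    moreover have "dist xp x\<^sub>0 \<le> dist v x\<^sub>0" if "?A v = y" for v
      by (rule power2_le_imp_le) (simp_all add: pyth[OF that])
    ultimately show "is_arg_min (\<lambda>u. dist u x\<^sub>0) (\<lambda>u. ?A u = y) u"
      using sol by (auto simp: is_arg_min_def not_less)
  qed
  with x_lim show ?thesis by blast
qed

end
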